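(* Let $(\mathsf{Seq}(\mathscr{L},\Rightarrow),\vdash)$ be a normal sequent structure having a witness function $v$ relative to a rule $T$, where $T$ is disjoint from the weakening and exchange rules, and let $n_0$ be the natural number associated with $v$ in the definition of witness function. Suppose that for every provable sequent $\Gamma\Rightarrow\Delta$ the following hold. (1) If $n_0<v(\Gamma\Rightarrow\Delta)$, then there exists a provable sequent $\Gamma'\Rightarrow\Delta'$ such that $v(\Gamma'\Rightarrow\Delta')<v(\Gamma\Rightarrow\Delta)$. (2) If this sequent $\Gamma'\Rightarrow\Delta'$ has a $T$-free proof, then so does $\Gamma\Rightarrow\Delta$. Then every provable sequent has a $T$-free proof.
   Context: Sequents. For a set $\mathscr{L}$, let $\boldsymbol{FO}(\mathscr{L})$ be the set of finite ordered lists of elements of $\mathscr{L}$, and let $\Rightarrow\,\subseteq\boldsymbol{FO}(\mathscr{L})\times\boldsymbol{FO}(\mathscr{L})$. A sequent is a pair $(\Gamma,\Delta)\in\,\Rightarrow$, written $\Gamma\Rightarrow\Delta$; $\mathsf{Seq}(\mathscr{L},\Rightarrow)$ is the set of all sequents. Rules. A rule is a nonempty set $R\subseteq\mathsf{Seq}(\mathscr{L},\Rightarrow)^n\times\mathsf{Seq}(\mathscr{L},\Rightarrow)$ for some $n\in\mathbb{N}=\{0,1,\ldots\}$. It is axiomatic if $\emptyset\subsetneq R\subseteq\{\emptyset\}\times\mathsf{Seq}(\mathscr{L},\Rightarrow)$, and non-axiomatic otherwise. An element $((S_1,\ldots,S_n),S)\in R$ is an instance of $R$, with premises $S_1,\ldots,S_n$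 and conclusion $S$. The weakening rules are WL (from $\Gamma\Rightarrow\Delta$ infer $A,\Gamma\Rightarrow\Delta$) and WR (from $\Gamma\Rightarrow\Delta$ infer $\Gamma\Rightarrow\Delta,A$); the exchange rules are EL (from $\Gamma,A,B,\Pi\Rightarrow\Delta$ infer $\Gamma,B,A,\Pi\Rightarrow\Delta$) and ER (from $\Gamma\Rightarrow\Delta,A,B,\Sigma$ infer $\Gamma\Rightarrow\Delta,B,A,\Sigma$). Normal sequent structure. Let $\mathscr{L}$ be the formula algebra (set of formulas) built inductively over a nonempty set $V$ of variables with a finite set of connectives, equipped with a set of rules, and let $\vdash\,\subseteq\mathcal{P}(\mathsf{Seq}(\mathscr{L},\Rightarrow))\times\mathsf{Seq}(\mathscr{L},\Rightarrow)$. The pair $(\mathsf{Seq}(\mathscr{L},\Rightarrow),\vdash)$ is a normal sequent structure if: (i) $p\Rightarrow p$ for all $p\in V$, and $\emptyset\vdash p\Rightarrow p$ for all $p\in V$; (ii) the weakening and exchange rules are included in the set of rules; (iii) $\emptyset\vdash\Gamma\Rightarrow\Delta$ means that $\Gamma\Rightarrow\Delta$ is provable, i.e. has a proof: a finite tree of sequents with root $\Gamma\Rightarrow\Delta$, whose leaves are conclusions of instances of axiomatic rules and in which each other node is the conclusion of an instance of a rule with the children of the node as premises; (iv) if $\Gamma\Rightarrow\Delta$ is provable and $\Gamma,\Delta$ both contain only variables, then some $p\in V$ is common to both lists $\Gamma$ and $\Delta$; (v) if $\Gamma\Rightarrow\Delta$ is provable, then $\Gamma$ is not the empty list or $\Delta$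 is not the empty list. A proof is $T$-free if it contains no application of $T$. Witness function. A function $v:\mathsf{Seq}(\mathscr{L},\Rightarrow)\to\mathbb{N}$ is a witness function relative to the rule $T$ if: (i) there is $n_0\in\mathbb{N}$ such that $v(\Gamma\Rightarrow\Delta)=n_0$ implies that $\Gamma$ and $\Delta$ contain at most variables, and $v(\Gamma\Rightarrow\Delta)\ge n_0$ for all sequents $\Gamma\Rightarrow\Delta$; (ii) $v$ does not respect any instance of $T$, where $v$ respects an instance $((\Gamma_1\Rightarrow\Delta_1,\ldots,\Gamma_m\Rightarrow\Delta_m),\Gamma\Rightarrow\Delta)$ of a non-axiomatic rule if $v(\Gamma_i\Rightarrow\Delta_i)\le v(\Gamma\Rightarrow\Delta)$ for all $i\in\{1,\ldots,m\}$.
   Formalization: Each p ⇒ p is assumed to be the conclusion of an axiomatic rule, not merely provable; otherwise T could be indispensable for proving p ⇒ p and the claim fails. Weakening and exchange apply to all sequents, so the set of sequents is closed under them. *)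

theory Defs
  imports Main
begin

datatype ('v, 'c) fm = Var 'v | Conn 'c "('v, 'c) fm list"

text \<open>The formula algebra over the set of variables \<open>V\<close> and the set of connectives \<open>C\<close>,
  where \<open>ar c\<close> is the arity of the connective \<open>c\<close>.\<close>

inductive_set formulas :: "'v set \<Rightarrow> 'c set \<Rightarrow> ('c \<Rightarrow> nat) \<Rightarrow> ('v, 'c) fm set"
  for V :: "'v set" and C :: "'c set" and ar :: "'c \<Rightarrow> nat" where
  "p \<in> V \<Longrightarrow> Var p \<in> formulas V C ar"
| "c \<in> C \<Longrightarrow> length As = ar c \<Longrightarrow> \<forall>A\<in>set As. A \<in> formulas V C ar \<Longrightarrow>
     Conn c As \<in> formulas V C ar"

type_synonym 'f seqt = "'f list \<times> 'f list"
type_synonym 'f inst = "'f seqt list \<times> 'f seqt"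

text \<open>Throughout, \<open>Sq\<close> is the relation \<open>\<Rightarrow>\<close>, i.e. the set of all sequents.\<close>

definition is_rule :: "'f seqt set \<Rightarrow> 'f inst set \<Rightarrow> bool" where
  "is_rule Sq R \<longleftrightarrow> R \<noteq> {} \<and> (\<exists>n. R \<subseteq> {Ss. set Ss \<subseteq> Sq \<and> length Ss = n} \<times> Sq)"

definition axiomatic :: "'f seqt set \<Rightarrow> 'f inst set \<Rightarrow> bool" where
  "axiomatic Sq R \<longleftrightarrow> R \<noteq> {} \<and> R \<subseteq> {[]} \<times> Sq"

text \<open>The structural rules apply to every sequent of the required shape and every formula in \<open>L\<close>;
  their conclusions are not restricted to \<open>Sq\<close>.  Hence requiring them to be rules (in the
  sense of \<open>is_rule\<close>) entails that \<open>Sq\<close> is closed under weakening and exchange.\<close>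

definition WL :: "'f set \<Rightarrow> 'f seqt set \<Rightarrow> 'f inst set" where
  "WL L Sq = {([(\<Gamma>, \<Delta>)], (A # \<Gamma>, \<Delta>)) | A \<Gamma> \<Delta>. A \<in> L \<and> (\<Gamma>, \<Delta>) \<in> Sq}"

definition WR :: "'f set \<Rightarrow> 'f seqt set \<Rightarrow> 'f inst set" where
  "WR L Sq = {([(\<Gamma>, \<Delta>)], (\<Gamma>, \<Delta> @ [A])) | A \<Gamma> \<Delta>. A \<in> L \<and> (\<Gamma>, \<Delta>) \<in> Sq}"

definition EL :: "'f seqt set \<Rightarrow> 'f inst set" where
  "EL Sq = {([(\<Gamma> @ [A, B] @ \<Pi>, \<Delta>)], (\<Gamma> @ [B, A] @ \<Pi>, \<Delta>)) | A B \<Gamma> \<Pi> \<Delta>.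
     (\<Gamma> @ [A, B] @ \<Pi>, \<Delta>) \<in> Sq}"

definition ER :: "'f seqt set \<Rightarrow> 'f inst set" where
  "ER Sq = {([(\<Gamma>, \<Delta> @ [A, B] @ \<Sigma>)], (\<Gamma>, \<Delta> @ [B, A] @ \<Sigma>)) | A B \<Gamma> \<Delta> \<Sigma>.
     (\<Gamma>, \<Delta> @ [A, B] @ \<Sigma>) \<in> Sq}"

datatype 'f ptree = Node (root: "'f seqt") "'f ptree list"

primrec is_proof :: "'f seqt set \<Rightarrow> 'f inst set set \<Rightarrow> 'f ptree \<Rightarrow> bool" where
  "is_proof Sq Rs (Node S ts) \<longleftrightarrow>
     (if ts = [] then \<exists>R\<in>Rs. axiomatic Sq R \<and> ([], S) \<in> R
      else \<exists>R\<in>Rs. (map root ts, S) \<in> R) \<and>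
     list_all (is_proof Sq Rs) ts"

text \<open>Proofs are trees of sequents, not annotated with rules; so an application of \<open>T\<close> is a node
  which, together with its children, forms an instance of \<open>T\<close> (even if some other rule happens
  to contain that instance too).\<close>

primrec rule_free :: "'f inst set \<Rightarrow> 'f ptree \<Rightarrow> bool" where
  "rule_free T (Node S ts) \<longleftrightarrow> (map root ts, S) \<notin> T \<and> list_all (rule_free T) ts"

definition provable :: "'f seqt set \<Rightarrow> 'f inst set set \<Rightarrow> 'f seqt \<Rightarrow> bool" where
  "provable Sq Rs S \<longleftrightarrow> (\<exists>t. is_proof Sq Rs t \<and> root t = S)"

definition has_free_proof :: "'f seqt set \<Rightarrow> 'f inst set set \<Rightarrow> 'f inst set \<Rightarrow> 'f seqt \<Rightarrow> bool" where
  "has_free_proof Sq Rs T S \<longleftrightarrow> (\<exists>t. is_proof Sq Rs t \<and> rule_free T t \<and> root t = S)"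

definition only_vars :: "'v set \<Rightarrow> ('v, 'c) fm list \<Rightarrow> bool" where
  "only_vars V \<Gamma> \<longleftrightarrow> set \<Gamma> \<subseteq> Var ` V"

text \<open>The relation \<open>\<turnstile>\<close> is the parameter \<open>ent\<close>.

  The clause \<open>ident_axiom\<close> spells out that the sequents \<open>p \<Rightarrow> p\<close> are initial sequents.  Mere
  provability (\<open>ident_ent\<close>) would allow the rule to be eliminated to be indispensable for proving
  \<open>p \<Rightarrow> p\<close> itself: take one variable \<open>p\<close>, one constant \<open>c\<close>, all sequents, the structural rules,
  the axiom \<open>c \<Rightarrow> c\<close> and the rule \<open>T\<close> whose only instance infers \<open>p \<Rightarrow> p\<close> from \<open>c \<Rightarrow> c\<close>,
  with \<open>v S = 0\<close> if \<open>S\<close> contains only variables and \<open>v S = 1\<close> otherwise.  Then \<open>p \<Rightarrow> p\<close> is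
  provable, but only by means of \<open>T\<close>, although \<open>v\<close> is a witness function relative to \<open>T\<close>.\<close>

locale normal_sequent_structure =
  fixes V :: "'v set" and C :: "'c set" and ar :: "'c \<Rightarrow> nat"
    and Sq :: "('v, 'c) fm seqt set"
    and Rs :: "('v, 'c) fm inst set set"
    and ent :: "('v, 'c) fm seqt set \<Rightarrow> ('v, 'c) fm seqt \<Rightarrow> bool"
  assumes V_nonempty: "V \<noteq> {}"
    and C_finite: "finite C"
    and sequents: "Sq \<subseteq> lists (formulas V C ar) \<times> lists (formulas V C ar)"
    and rules: "\<And>R. R \<in> Rs \<Longrightarrow> is_rule Sq R"
    and ent_sequents: "\<And>X S. ent X S \<Longrightarrow> X \<subseteq> Sq \<and> S \<in> Sq"
    and ident_sequent: "\<And>p. p \<in> V \<Longrightarrow> ([Var p], [Var p]) \<in> Sq"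
    and ident_ent: "\<And>p. p \<in> V \<Longrightarrow> ent {} ([Var p], [Var p])"
    and ident_axiom: "\<And>p. p \<in> V \<Longrightarrow> \<exists>R\<in>Rs. axiomatic Sq R \<and> ([], ([Var p], [Var p])) \<in> R"
    and structural: "{WL (formulas V C ar) Sq, WR (formulas V C ar) Sq, EL Sq, ER Sq} \<subseteq> Rs"
    and ent_empty: "\<And>S. ent {} S \<longleftrightarrow> provable Sq Rs S"
    and common_var: "\<And>\<Gamma> \<Delta>. provable Sq Rs (\<Gamma>, \<Delta>) \<Longrightarrow> only_vars V \<Gamma> \<Longrightarrow> only_vars V \<Delta> \<Longrightarrow>
        \<exists>p\<in>V. Var p \<in> set \<Gamma> \<and> Var p \<in> set \<Delta>"
    and consistent: "\<And>\<Gamma> \<Delta>. provable Sq Rs (\<Gamma>, \<Delta>) \<Longrightarrow> \<Gamma> \<noteq> [] \<or> \<Delta> \<noteq> []"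

definition respects_inst :: "('f seqt \<Rightarrow> nat) \<Rightarrow> 'f inst \<Rightarrow> bool" where
  "respects_inst v I \<longleftrightarrow> (\<forall>S\<in>set (fst I). v S \<le> v (snd I))"

definition witness_base :: "'v set \<Rightarrow> ('v, 'c) fm seqt set \<Rightarrow> (('v, 'c) fm seqt \<Rightarrow> nat) \<Rightarrow> nat \<Rightarrow> bool" where
  "witness_base V Sq v n0 \<longleftrightarrow>
     (\<forall>(\<Gamma>, \<Delta>)\<in>Sq. v (\<Gamma>, \<Delta>) = n0 \<longrightarrow> only_vars V \<Gamma> \<and> only_vars V \<Delta>) \<and>
     (\<forall>S\<in>Sq. n0 \<le> v S)"

text \<open>An axiomatic rule has no witness function: its instances have no premises and are therefore
  respected by any \<open>v\<close>.\<close>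

definition witness_function ::
  "'v set \<Rightarrow> ('v, 'c) fm seqt set \<Rightarrow> ('v, 'c) fm inst set \<Rightarrow> (('v, 'c) fm seqt \<Rightarrow> nat) \<Rightarrow> bool" where
  "witness_function V Sq T v \<longleftrightarrow>
     (\<exists>n0. witness_base V Sq v n0) \<and> (\<forall>I\<in>T. \<not> respects_inst v I)"

end

theory Submission
  imports Defs
begin

text \<open>Call a sequent \<^emph>\<open>cleanly provable\<close> if it has a \<open>T\<close>-free proof. The hypothesis of the theorem
  is the step of a strong induction on \<open>v\<close>: it reduces clean provability of a provable sequent
  whose value exceeds \<open>n0\<close> to that of a provable sequent of smaller value. The content lies in the
  base case.

  A provable sequent of value \<open>n0\<close> consists of variables only, so it has a variable \<open>p\<close> on both
  sides. It can therefore be obtained from the initial sequent \<open>p \<Rightarrow> p\<close> by weakening and exchange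
  alone (\<open>shared_var_free_proof\<close>). This derivation is \<open>T\<close>-free: its unary inferences belong to
  structural rules, which are disjoint from \<open>T\<close>, and its leaf is not an instance of \<open>T\<close> because
  every valuation respects an instance without premises, whereas a witness function respects no
  instance of \<open>T\<close>.\<close>

text \<open>This is the combinatorics of weakening and exchange on one side of a sequent. For a target
  \<open>us @ a # ws\<close>, the property is propagated from \<open>[a]\<close> to \<open>ws @ [a]\<close>, then to \<open>a # ws\<close> by moving \<open>a\<close>
  across \<open>ws\<close>, and then to the target; so elements are added at the front only. The other side, where weakening adds at the end, is the same statement for reversed
  lists.\<close>

lemma weakening_exchange_closure:
  assumes start: "P [a]"
    and add: "\<And>b xs. b \<in> L \<Longrightarrow> P xs \<Longrightarrow> P (b # xs)"
    and swap: "\<And>xs b c ys. P (xs @ [b, c] @ ys) \<Longrightarrow> P (xs @ [c, b] @ ys)"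
    and "a \<in> set zs" and "set zs \<subseteq> L"
  shows "P zs"
proof -
  obtain us ws where zs: "zs = us @ a # ws"
    using \<open>a \<in> set zs\<close> by (meson split_list)
  have prepend: "P (xs @ ys)" if "set xs \<subseteq> L" "P ys" for xs ys
    using that by (induction xs) (auto intro: add)
  have to_front: "P (a # xs @ ys)" if "P (xs @ a # ys)" for xs ys
    using that
  proof (induction xs arbitrary: ys rule: rev_induct)
    case (snoc x xs)
    then have "P (xs @ [a, x] @ ys)"
      using swap[of xs x a ys] by simp
    then show ?case
      using snoc.IH[of "x # ys"] by simp
  qed simp
  have "P (ws @ [a])"
    using assms(5) start by (intro prepend) (auto simp: zs)
  then have "P (a # ws)"
    using to_front[of ws "[]"] by simp
  then show ?thesis
    using assms(5) unfolding zs by (intro prepend) auto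
qed

context normal_sequent_structure
begin

lemma provable_in_sequents: "provable Sq Rs S \<Longrightarrow> S \<in> Sq"
  using ent_empty ent_sequents by blast

lemma free_proof_provable: "has_free_proof Sq Rs T S \<Longrightarrow> provable Sq Rs S"
  unfolding has_free_proof_def provable_def by blast

lemma free_proof_step:
  assumes "has_free_proof Sq Rs T S" and "R \<in> Rs" and "([S], S') \<in> R" and "([S], S') \<notin> T"
  shows "has_free_proof Sq Rs T S'"
proof -
  obtain t where "is_proof Sq Rs t" "rule_free T t" "root t = S"
    using assms(1) unfolding has_free_proof_def by blast
  then have "is_proof Sq Rs (Node S' [t])" "rule_free T (Node S' [t])"
    using assms(2-4) by auto
  then show ?thesis
    unfolding has_free_proof_def by (metis ptree.sel(1))
qed

lemma identity_free_proof:
  assumes "p \<in> V" and no_leaf: "\<And>S. ([], S) \<notin> T"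
  shows "has_free_proof Sq Rs T ([Var p], [Var p])"
proof -
  let ?t = "Node ([Var p], [Var p]) []"
  have "is_proof Sq Rs ?t" "rule_free T ?t"
    using ident_axiom[OF \<open>p \<in> V\<close>] no_leaf by auto
  then show ?thesis
    unfolding has_free_proof_def by (metis ptree.sel(1))
qed

text \<open>The initial sequent \<open>p \<Rightarrow> p\<close> is first enlarged to \<open>\<Gamma> \<Rightarrow> p\<close> and then to \<open>\<Gamma> \<Rightarrow> \<Delta>\<close>.\<close>

lemma shared_var_free_proof:
  assumes no_leaf: "\<And>S. ([], S) \<notin> T"
    and disjoint: "T \<inter> (WL (formulas V C ar) Sq \<union> WR (formulas V C ar) Sq \<union> EL Sq \<union> ER Sq) = {}"
    and "p \<in> V" and "Var p \<in> set \<Gamma>" and "Var p \<in> set \<Delta>"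
    and "set \<Gamma> \<subseteq> formulas V C ar" and "set \<Delta> \<subseteq> formulas V C ar"
  shows "has_free_proof Sq Rs T (\<Gamma>, \<Delta>)"
proof -
  let ?L = "formulas V C ar"
  let ?free = "has_free_proof Sq Rs T"
  have in_Sq: "S \<in> Sq" if "?free S" for S
    using that by (intro provable_in_sequents free_proof_provable)
  have structural_step: "?free S'"
    if free: "?free S" and inst: "([S], S') \<in> WL ?L Sq \<union> WR ?L Sq \<union> EL Sq \<union> ER Sq" for S S'
  proof -
    obtain R where "R \<in> Rs" "([S], S') \<in> R"
      using inst structural by blast
    moreover have "([S], S') \<notin> T"
      using inst disjoint by blast
    ultimately show ?thesis
      using free by (intro free_proof_step[of T S R S'])
  qed
  have left: "?free (\<Gamma>, [Var p])"
  proof (rule weakening_exchange_closure[where P = "\<lambda>\<Gamma>. ?free (\<Gamma>, [Var p])" and L = ?L])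
    show "?free ([Var p], [Var p])"
      using \<open>p \<in> V\<close> no_leaf by (rule identity_free_proof)
  next
    fix A \<Gamma> assume "A \<in> ?L" "?free (\<Gamma>, [Var p])"
    moreover from this have "([(\<Gamma>, [Var p])], (A # \<Gamma>, [Var p])) \<in> WL ?L Sq"
      using in_Sq by (auto simp: WL_def)
    ultimately show "?free (A # \<Gamma>, [Var p])"
      using structural_step by blast
  next
    fix \<Gamma> A B \<Pi> assume *: "?free (\<Gamma> @ [A, B] @ \<Pi>, [Var p])"
    then have "([(\<Gamma> @ [A, B] @ \<Pi>, [Var p])], (\<Gamma> @ [B, A] @ \<Pi>, [Var p])) \<in> EL Sq"
      using in_Sq unfolding EL_def by blast
    then show "?free (\<Gamma> @ [B, A] @ \<Pi>, [Var p])"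
      using * structural_step by blast
  qed (use assms in auto)
  have "?free (\<Gamma>, rev (rev \<Delta>))"
  proof (rule weakening_exchange_closure[where P = "\<lambda>\<Delta>. ?free (\<Gamma>, rev \<Delta>)" and L = ?L])
    show "?free (\<Gamma>, rev [Var p])"
      using left by simp
  next
    fix A \<Delta> assume "A \<in> ?L" "?free (\<Gamma>, rev \<Delta>)"
    moreover from this have "([(\<Gamma>, rev \<Delta>)], (\<Gamma>, rev (A # \<Delta>))) \<in> WR ?L Sq"
      using in_Sq by (auto simp: WR_def)
    ultimately show "?free (\<Gamma>, rev (A # \<Delta>))"
      using structural_step by blast
  next
    fix \<Delta> A B \<Sigma> assume "?free (\<Gamma>, rev (\<Delta> @ [A, B] @ \<Sigma>))"
    then have *: "?free (\<Gamma>, rev \<Sigma> @ [B, A] @ rev \<Delta>)"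
      by simp
    then have "([(\<Gamma>, rev \<Sigma> @ [B, A] @ rev \<Delta>)], (\<Gamma>, rev \<Sigma> @ [A, B] @ rev \<Delta>)) \<in> ER Sq"
      using in_Sq unfolding ER_def by blast
    then have "?free (\<Gamma>, rev \<Sigma> @ [A, B] @ rev \<Delta>)"
      using * structural_step by blast
    then show "?free (\<Gamma>, rev (\<Delta> @ [B, A] @ \<Sigma>))"
      by simp
  qed (use assms in auto)
  then show ?thesis
    by simp
qed

end

theorem theorem3p5:
  fixes V :: "'v set" and C :: "'c set" and ar :: "'c \<Rightarrow> nat"
    and Sq :: "('v, 'c) fm seqt set"
    and Rs :: "('v, 'c) fm inst set set"
    and ent :: "('v, 'c) fm seqt set \<Rightarrow> ('v, 'c) fm seqt \<Rightarrow> bool"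
    and T :: "('v, 'c) fm inst set"
    and v :: "('v, 'c) fm seqt \<Rightarrow> nat" and n0 :: nat
  assumes "normal_sequent_structure V C ar Sq Rs ent"
    and "is_rule Sq T"
    and "witness_function V Sq T v"
    and "witness_base V Sq v n0"
    and "T \<inter> (WL (formulas V C ar) Sq \<union> WR (formulas V C ar) Sq \<union> EL Sq \<union> ER Sq) = {}"
    and "\<And>\<Gamma> \<Delta>. provable Sq Rs (\<Gamma>, \<Delta>) \<Longrightarrow> n0 < v (\<Gamma>, \<Delta>) \<Longrightarrow>
           \<exists>\<Gamma>' \<Delta>'. provable Sq Rs (\<Gamma>', \<Delta>') \<and> v (\<Gamma>', \<Delta>') < v (\<Gamma>, \<Delta>) \<and>
             (has_free_proof Sq Rs T (\<Gamma>', \<Delta>') \<longrightarrow> has_free_proof Sq Rs T (\<Gamma>, \<Delta>))"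
  shows "\<forall>\<Gamma> \<Delta>. provable Sq Rs (\<Gamma>, \<Delta>) \<longrightarrow> has_free_proof Sq Rs T (\<Gamma>, \<Delta>)"
proof -
  interpret normal_sequent_structure V C ar Sq Rs ent
    by (fact assms(1))
  have no_leaf: "([], S) \<notin> T" for S
  proof
    assume "([], S) \<in> T"
    then have "\<not> respects_inst v ([], S)"
      using assms(3) unfolding witness_function_def by blast
    then show False
      by (simp add: respects_inst_def)
  qed
  have "has_free_proof Sq Rs T S" if "provable Sq Rs S" for S
    using that
  proof (induction "v S" arbitrary: S rule: less_induct)
    case less
    obtain \<Gamma> \<Delta> where S: "S = (\<Gamma>, \<Delta>)"
      by (cases S)
    have "S \<in> Sq"
      using less.prems by (rule provable_in_sequents)
    show ?case
    proof (cases "n0 < v S")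
      case True
      then show ?thesis
        using assms(6)[of \<Gamma> \<Delta>] less unfolding S by blast
    next
      case False
      have vars: "only_vars V \<Gamma>" "only_vars V \<Delta>"
        using False \<open>S \<in> Sq\<close> assms(4) unfolding witness_base_def S by fastforce+
      then obtain p where p: "p \<in> V" "Var p \<in> set \<Gamma>" "Var p \<in> set \<Delta>"
        using common_var less.prems unfolding S by blast
      have "set \<Gamma> \<subseteq> formulas V C ar" "set \<Delta> \<subseteq> formulas V C ar"
        using sequents \<open>S \<in> Sq\<close> unfolding S by auto
      then show ?thesis
        unfolding S by (rule shared_var_free_proof[OF no_leaf assms(5) p])
    qed
  qed
  then show ?thesis
    by blast
qed

end
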